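(* Let $F$ be an exact linear CNF formula, and let $L := \max_{x \in V(F)} l(x)$ be the largest number of occurrences of a variable in $F$. Then there are at most $L$ clauses $C \in F$ with $|C| < L$.
   Context: A literal is a Boolean variable or its negation. A clause is a finite non-empty set (disjunction) of literals that does not contain both a variable and its negation; $|C|$ is the number of literals of $C$ and $V(C)$ is the set of variables occurring in $C$ (so $|C| = |V(C)|$). A CNF formula $F$ is a finite non-empty set (conjunction) of clauses; $V(F)$ is the set of variables occurring in $F$. For $x \in V(F)$, $l(x)$ denotes the number of occurrences of $x$ in $F$ (positive or negated), i.e. the number of clauses $C \in F$ with $x \in V(C)$. $F$ is exact linear if any two distinct clauses $C, C' \in F$ have exactly one variable in common, i.e. $|V(C) \cap V(C')| = 1$. *)

theory Defs
  imports Main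
begin

datatype 'v literal = Pos 'v | Neg 'v

fun var_of :: "'v literal \<Rightarrow> 'v" where
  "var_of (Pos x) = x"
| "var_of (Neg x) = x"

definition is_clause :: "'v literal set \<Rightarrow> bool" where
  "is_clause C \<longleftrightarrow> finite C \<and> C \<noteq> {} \<and> (\<forall>x. \<not> (Pos x \<in> C \<and> Neg x \<in> C))"

definition clause_vars :: "'v literal set \<Rightarrow> 'v set" where
  "clause_vars C = var_of ` C"

definition is_cnf :: "'v literal set set \<Rightarrow> bool" where
  "is_cnf F \<longleftrightarrow> finite F \<and> F \<noteq> {} \<and> (\<forall>C\<in>F. is_clause C)"

definition cnf_vars :: "'v literal set set \<Rightarrow> 'v set" where
  "cnf_vars F = (\<Union>C\<in>F. clause_vars C)"

definition occurrences :: "'v literal set set \<Rightarrow> 'v \<Rightarrow> nat" where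
  "occurrences F x = card {C \<in> F. x \<in> clause_vars C}"

definition exact_linear :: "'v literal set set \<Rightarrow> bool" where
  "exact_linear F \<longleftrightarrow>
     (\<forall>C\<in>F. \<forall>C'\<in>F. C \<noteq> C' \<longrightarrow> card (clause_vars C \<inter> clause_vars C') = 1)"

text \<open>For a CNF formula the set of variables is finite and non-empty, so the maximum is attained.\<close>

definition max_occurrences :: "'v literal set set \<Rightarrow> nat" where
  "max_occurrences F = Max (occurrences F ` cnf_vars F)"

end

theory Submission
  imports Defs
begin

text \<open>The clauses through a variable \<open>x\<close> meet a clause avoiding \<open>x\<close> in pairwise different
  variables, so a clause avoiding \<open>x\<close> has at least \<open>l(x)\<close> literals. Taking \<open>x\<close> with \<open>l(x) = L\<close>,
  every clause shorter than \<open>L\<close> contains \<open>x\<close>, and there are only \<open>L\<close> of those.\<close>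

lemma occurrences_le_card_clause:
  assumes cnf: "is_cnf F" and lin: "exact_linear F"
    and C: "C \<in> F" and x: "x \<notin> clause_vars C"
  shows "occurrences F x \<le> card C"
proof -
  let ?S = "{D \<in> F. x \<in> clause_vars D}"
  have fin: "finite C"
    using cnf C by (auto simp: is_cnf_def is_clause_def)
  \<comment> \<open>Exact linearity speaks only of distinct clauses; \<open>x\<close> separates
    \<open>D\<close> from \<open>C\<close>, so it yields a shared variable for \<open>f\<close> to
    pick.\<close>
  have "\<exists>y. y \<in> clause_vars D \<inter> clause_vars C" if "D \<in> ?S" for D
  proof -
    have "D \<noteq> C" using that x by auto
    then have "card (clause_vars D \<inter> clause_vars C) = 1"
      using lin that C by (auto simp: exact_linear_def)
    then show ?thesis by (auto simp: card_1_singleton_iff)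
  qed
  then obtain f where f: "\<And>D. D \<in> ?S \<Longrightarrow> f D \<in> clause_vars D \<inter> clause_vars C"
    by metis
  have "inj_on f ?S"
  proof (rule inj_onI, rule ccontr)
    fix D D' assume D: "D \<in> ?S" and D': "D' \<in> ?S" and eq: "f D = f D'" and "D \<noteq> D'"
    then have "card (clause_vars D \<inter> clause_vars D') = 1"
      using lin by (auto simp: exact_linear_def)
    then obtain z where z: "clause_vars D \<inter> clause_vars D' = {z}"
      by (auto simp: card_1_singleton_iff)
    \<comment> \<open>Both \<open>x\<close> and the common value \<open>f D\<close> lie in the
      singleton intersection, so they coincide; but \<open>f D\<close> occurs in \<open>C\<close>
      and \<open>x\<close> does not.\<close>
    have "f D \<in> clause_vars D \<inter> clause_vars D'" "x \<in> clause_vars D \<inter> clause_vars D'"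
      using f[OF D] f[OF D'] D D' eq by auto
    then have "x = f D" using z by auto
    then show False using f[OF D] x by auto
  qed
  moreover have "f ` ?S \<subseteq> clause_vars C" using f by blast
  ultimately have "card ?S \<le> card (clause_vars C)"
    using fin by (intro card_inj_on_le[of f]) (auto simp: clause_vars_def)
  also have "\<dots> \<le> card C"
    unfolding clause_vars_def by (rule card_image_le[OF fin])
  finally show ?thesis by (simp add: occurrences_def)
qed

theorem theorem1:
  fixes F :: "'v literal set set" and L :: nat
  assumes "is_cnf F"
    and "exact_linear F"
    and "L = max_occurrences F"
  shows "card {C \<in> F. card C < L} \<le> L"
proof -
  \<comment> \<open>These two facts make \<open>Max\<close> a value attained at some
    variable.\<close>
  have "finite (cnf_vars F)" "cnf_vars F \<noteq> {}"
    using assms(1) by (auto simp: cnf_vars_def clause_vars_def is_cnf_def is_clause_def)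
  then have "L \<in> occurrences F ` cnf_vars F"
    unfolding assms(3) max_occurrences_def by (intro Max_in) auto
  then obtain x where x: "occurrences F x = L" by auto
  \<comment> \<open>Contrapositive use of the lemma: a clause avoiding \<open>x\<close> has at least
    \<open>occurrences F x = L\<close> literals.\<close>
  have "{C \<in> F. card C < L} \<subseteq> {C \<in> F. x \<in> clause_vars C}"
    using occurrences_le_card_clause[OF assms(1,2), of _ x] x by (auto simp: not_less[symmetric])
  moreover have "finite F" using assms(1) by (simp add: is_cnf_def)
  ultimately have "card {C \<in> F. card C < L} \<le> occurrences F x"
    unfolding occurrences_def by (intro card_mono) auto
  then show ?thesis by (simp add: x)
qed

end
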